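(* Let $A$ be a type of $\Lambda_{\mathbb R}$, let $f,f'\in|A\Rightarrow\mathsf{Real}|$ and $a,a'\in\mathcal Q_{A\Rightarrow\mathsf{Real}}$. Suppose that (1) $|f(x)-f'(x)|\sqsupseteq a(x)(b)$ (i.e. $|f(x)-f'(x)|\le a(x)(b)$) for all $(x,b,x')\in\rho_A$; and (2) $(f,a',f)\in\rho_{A\Rightarrow\mathsf{Real}}$ and $(f',a',f')\in\rho_{A\Rightarrow\mathsf{Real}}$. Then $(f,a\otimes a',f')\in\rho_{A\Rightarrow\mathsf{Real}}$.
   Context: Types: $A::=\mathsf{Real}\mid A\times B\mid A\Rightarrow B$. Lawvere quantale: $[0,+\infty]$ with reversed order ($a\sqsubseteq b$ iff $a\ge b$; top is $0$) and $\otimes=+$. For each type define a set $|A|$, a quantale $\mathcal Q_A$ and a relation $\rho_A\subseteq|A|\times\mathcal Q_A\times|A|$: $|\mathsf{Real}|=\mathbb R$, $\mathcal Q_{\mathsf{Real}}=[0,+\infty]$, $(x,a,x')\in\rho_{\mathsf{Real}}$ iff $|x-x'|\le a$; $|A\times B|=|A|\times|B|$, $\mathcal Q_{A\times B}=\mathcal Q_A\times\mathcal Q_B$, $\rho_{A\times B}$ componentwise; $|A\Rightarrow B|$ is the set of all functions $|A|\to|B|$, $\mathcal Q_{A\Rightarrow B}$ is the set of functions from $|A|$ to monotone maps $\mathcal Q_A\to\mathcal Q_B$ with pointwise order and $\otimes$, and $(f,a,f')\in\rho_{A\Rightarrow B}$ iff for all $(x,b,x')\in\rho_A$, $(f(x),a(x)(b),f'(x'))\in\rho_B$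 and $(f(x),a(x)(b),f(x'))\in\rho_B$. *)

theory Defs
  imports "HOL-Library.FuncSet" "HOL-Library.Extended_Nonnegative_Real"
begin

datatype ty = RealT | ProdT ty ty | FunT ty ty

record ('x, 'q) space =
  points :: "'x set"
  quant :: "'q set"
  qle :: "'q \<Rightarrow> 'q \<Rightarrow> bool"
  tensor :: "'q \<Rightarrow> 'q \<Rightarrow> 'q"
  rho :: "('x \<times> 'q \<times> 'x) set"

text \<open>
  A \<open>space\<close> carries the data attached to a type \<open>A\<close>: the set \<open>|A|\<close>, the quantale \<open>Q_A\<close> (carrier,
  order, tensor) and the relation \<open>\<rho>_A\<close>. The constructions \<open>real_space\<close>, \<open>prod_space\<close> and
  \<open>fun_space\<close> are the three clauses of the definition of this data. Functions with domain a
  carrier set are extensional (\<open>undefined\<close> outside the carrier).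
\<close>

text \<open>The order of the Lawvere quantale is the reverse of the usual order of \<open>[0, \<infinity>]\<close>.\<close>

definition real_space :: "(real, ennreal) space" where
  "real_space =
     \<lparr> points = UNIV,
       quant = UNIV,
       qle = (\<lambda>a b. a \<ge> b),
       tensor = (\<lambda>a b. a + b),
       rho = {(x, a, x'). ennreal \<bar>x - x'\<bar> \<le> a} \<rparr>"

definition prod_space ::
    "('x, 'q) space \<Rightarrow> ('y, 'r) space \<Rightarrow> ('x \<times> 'y, 'q \<times> 'r) space" where
  "prod_space S T =
     \<lparr> points = points S \<times> points T,
       quant = quant S \<times> quant T,
       qle = (\<lambda>(a, b) (a', b'). qle S a a' \<and> qle T b b'),
       tensor = (\<lambda>(a, b) (a', b'). (tensor S a a', tensor T b b')),
       rho = {((x, y), (a, b), (x', y')) | x y a b x' y'.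
                (x, a, x') \<in> rho S \<and> (y, b, y') \<in> rho T} \<rparr>"

definition mono_maps :: "('x, 'q) space \<Rightarrow> ('y, 'r) space \<Rightarrow> ('q \<Rightarrow> 'r) set" where
  "mono_maps S T =
     {m \<in> quant S \<rightarrow>\<^sub>E quant T. \<forall>b \<in> quant S. \<forall>b' \<in> quant S. qle S b b' \<longrightarrow> qle T (m b) (m b')}"

definition fun_space ::
    "('x, 'q) space \<Rightarrow> ('y, 'r) space \<Rightarrow> ('x \<Rightarrow> 'y, 'x \<Rightarrow> 'q \<Rightarrow> 'r) space" where
  "fun_space S T =
     \<lparr> points = points S \<rightarrow>\<^sub>E points T,
       quant = points S \<rightarrow>\<^sub>E mono_maps S T,
       qle = (\<lambda>a a'. \<forall>x \<in> points S. \<forall>b \<in> quant S. qle T (a x b) (a' x b)),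
       tensor = (\<lambda>a a'. \<lambda>x \<in> points S. \<lambda>b \<in> quant S. tensor T (a x b) (a' x b)),
       rho = {(f, a, f'). f \<in> points S \<rightarrow>\<^sub>E points T \<and> f' \<in> points S \<rightarrow>\<^sub>E points T \<and>
                a \<in> points S \<rightarrow>\<^sub>E mono_maps S T \<and>
                (\<forall>x b x'. (x, b, x') \<in> rho S \<longrightarrow>
                   (f x, a x b, f' x') \<in> rho T \<and> (f x, a x b, f x') \<in> rho T)} \<rparr>"

text \<open>
  Automatic for the three constructions (lemmas \<open>wf_real_space\<close>, \<open>wf_prod_space\<close>, \<open>wf_fun_space\<close>);
  in \<open>space_iso\<close> it excludes copies with junk outside the carriers.
\<close>

definition wf_space :: "('x, 'q) space \<Rightarrow> bool" where
  "wf_space S \<longleftrightarrow>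
     rho S \<subseteq> points S \<times> quant S \<times> points S \<and>
     (\<forall>a \<in> quant S. \<forall>b \<in> quant S. tensor S a b \<in> quant S) \<and>
     (\<forall>a \<in> quant S. \<forall>a' \<in> quant S. \<forall>b \<in> quant S. \<forall>b' \<in> quant S.
        qle S a a' \<longrightarrow> qle S b b' \<longrightarrow> qle S (tensor S a b) (tensor S a' b'))"

definition space_iso ::
    "('x \<Rightarrow> 'y) \<Rightarrow> ('q \<Rightarrow> 'r) \<Rightarrow> ('x, 'q) space \<Rightarrow> ('y, 'r) space \<Rightarrow> bool" where
  "space_iso g h S T \<longleftrightarrow>
     wf_space S \<and> wf_space T \<and>
     bij_betw g (points S) (points T) \<and> bij_betw h (quant S) (quant T) \<and>
     (\<forall>a \<in> quant S. \<forall>b \<in> quant S. qle S a b \<longleftrightarrow> qle T (h a) (h b)) \<and>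
     (\<forall>a \<in> quant S. \<forall>b \<in> quant S. h (tensor S a b) = tensor T (h a) (h b)) \<and>
     (\<forall>x \<in> points S. \<forall>a \<in> quant S. \<forall>x' \<in> points S.
        (x, a, x') \<in> rho S \<longleftrightarrow> (g x, h a, g x') \<in> rho T)"

definition isomorphic :: "('x, 'q) space \<Rightarrow> ('y, 'r) space \<Rightarrow> bool" where
  "isomorphic S T \<longleftrightarrow> (\<exists>g h. space_iso g h S T)"

text \<open>
  \<open>interprets A S\<close>: \<open>S\<close> is (a copy of) the data \<open>|A|\<close>, \<open>Q_A\<close>, \<open>\<rho>_A\<close> of the type \<open>A\<close>.
  The map from \<open>A\<close> to this data cannot be a HOL function, because \<open>|A|\<close> lives in a HOL type that
  depends on \<open>A\<close>, and a single HOL type containing all the sets \<open>|A|\<close> need not exist (there are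
  iterated function spaces over the reals of every finite order). We therefore describe its graph
  up to isomorphism: the data of \<open>A\<close> and of its subtypes are represented as subsets of arbitrary,
  sufficiently large, HOL types \<open>'x\<close> and \<open>'q\<close>. The lemmas \<open>interprets_unique\<close>,
  \<open>interprets_RealT\<close>, \<open>interprets_ProdT\<close> and \<open>interprets_FunT\<close> below show that the data so described
  are unique up to isomorphism, exist for every type (for suitable \<open>'x\<close> and \<open>'q\<close>), and are given by
  the three constructions above.
\<close>

primrec interprets :: "ty \<Rightarrow> ('x, 'q) space \<Rightarrow> bool" where
  "interprets RealT = (\<lambda>U. isomorphic U real_space)"
| "interprets (ProdT A B) =
     (\<lambda>U. \<exists>S T. interprets A S \<and> interprets B T \<and> isomorphic U (prod_space S T))"
| "interprets (FunT A B) =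
     (\<lambda>U. \<exists>S T. interprets A S \<and> interprets B T \<and> isomorphic U (fun_space S T))"

lemma wf_real_space: "wf_space real_space"
  by (auto simp: wf_space_def real_space_def add_mono)

lemma wf_prod_space: "wf_space S \<Longrightarrow> wf_space T \<Longrightarrow> wf_space (prod_space S T)"
  unfolding wf_space_def prod_space_def by (auto; blast)

lemma wf_fun_space:
  assumes S: "wf_space S" and T: "wf_space T"
  shows "wf_space (fun_space S T)"
proof -
  have mm: "m b \<in> quant T" if "m \<in> mono_maps S T" "b \<in> quant S" for m b
    using that by (auto simp: mono_maps_def)
  have ten: "(\<lambda>x \<in> points S. \<lambda>b \<in> quant S. tensor T (a x b) (a' x b)) \<in> points S \<rightarrow>\<^sub>E mono_maps S T"
    if a: "a \<in> points S \<rightarrow>\<^sub>E mono_maps S T" and a': "a' \<in> points S \<rightarrow>\<^sub>E mono_maps S T" for a a'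
  proof (intro restrict_PiE_iff[THEN iffD2] ballI)
    fix x assume x: "x \<in> points S"
    have ax: "a x \<in> mono_maps S T" "a' x \<in> mono_maps S T" using a a' x by auto
    have "tensor T (a x b) (a' x b) \<in> quant T" if "b \<in> quant S" for b
      using T mm[OF ax(1) that] mm[OF ax(2) that] unfolding wf_space_def by blast
    moreover have "qle T (tensor T (a x b) (a' x b)) (tensor T (a x b') (a' x b'))"
      if b: "b \<in> quant S" "b' \<in> quant S" and le: "qle S b b'" for b b'
    proof -
      have "qle T (a x b) (a x b')" "qle T (a' x b) (a' x b')"
        using ax b le unfolding mono_maps_def by blast+
      then show ?thesis
        using T mm[OF ax(1)] mm[OF ax(2)] b unfolding wf_space_def by blast
    qed
    ultimately show "(\<lambda>b \<in> quant S. tensor T (a x b) (a' x b)) \<in> mono_maps S T"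
      by (auto simp: mono_maps_def)
  qed
  have le: "qle T (tensor T (a x c) (b x c)) (tensor T (a' x c) (b' x c))"
    if "a \<in> points S \<rightarrow>\<^sub>E mono_maps S T" "a' \<in> points S \<rightarrow>\<^sub>E mono_maps S T"
      "b \<in> points S \<rightarrow>\<^sub>E mono_maps S T" "b' \<in> points S \<rightarrow>\<^sub>E mono_maps S T"
      "qle T (a x c) (a' x c)" "qle T (b x c) (b' x c)" "x \<in> points S" "c \<in> quant S"
    for a a' b b' x c
  proof -
    have "a x c \<in> quant T" "a' x c \<in> quant T" "b x c \<in> quant T" "b' x c \<in> quant T"
      using that mm by (meson PiE_mem)+
    then show ?thesis using T that unfolding wf_space_def by blast
  qed
  show ?thesis
    unfolding wf_space_def
  proof (intro conjI ballI impI)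
    show "rho (fun_space S T) \<subseteq>
        points (fun_space S T) \<times> quant (fun_space S T) \<times> points (fun_space S T)"
      by (auto simp: fun_space_def)
  qed (use ten le in \<open>auto simp: fun_space_def\<close>)
qed

lemma isomorphic_wf: "isomorphic S T \<Longrightarrow> wf_space S \<and> wf_space T"
  by (auto simp: isomorphic_def space_iso_def)

lemma interprets_wf: "interprets A S \<Longrightarrow> wf_space S"
  by (cases A) (auto dest: isomorphic_wf)

text \<open>Isomorphisms with explicit inverses, the form used in the proofs.\<close>

definition iso_pair where
  "iso_pair g g' h h' S T \<longleftrightarrow>
     wf_space S \<and> wf_space T \<and>
     (\<forall>x \<in> points S. g x \<in> points T \<and> g' (g x) = x) \<and>
     (\<forall>y \<in> points T. g' y \<in> points S \<and> g (g' y) = y) \<and>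
     (\<forall>a \<in> quant S. h a \<in> quant T \<and> h' (h a) = a) \<and>
     (\<forall>b \<in> quant T. h' b \<in> quant S \<and> h (h' b) = b) \<and>
     (\<forall>a \<in> quant S. \<forall>b \<in> quant S. qle S a b \<longleftrightarrow> qle T (h a) (h b)) \<and>
     (\<forall>a \<in> quant S. \<forall>b \<in> quant S. h (tensor S a b) = tensor T (h a) (h b)) \<and>
     (\<forall>x \<in> points S. \<forall>a \<in> quant S. \<forall>x' \<in> points S.
        (x, a, x') \<in> rho S \<longleftrightarrow> (g x, h a, g x') \<in> rho T)"

lemma isomorphic_iff_iso_pair: "isomorphic S T \<longleftrightarrow> (\<exists>g g' h h'. iso_pair g g' h h' S T)"
proof
  assume "isomorphic S T"
  then obtain g h where gh: "space_iso g h S T" by (auto simp: isomorphic_def)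
  then have b: "bij_betw g (points S) (points T)" "bij_betw h (quant S) (quant T)"
    by (auto simp: space_iso_def)
  have "iso_pair g (inv_into (points S) g) h (inv_into (quant S) h) S T"
    using gh b bij_betw_inv_into_left[OF b(1)] bij_betw_inv_into_right[OF b(1)]
      bij_betw_inv_into_left[OF b(2)] bij_betw_inv_into_right[OF b(2)]
      bij_betw_inv_into[OF b(1)] bij_betw_inv_into[OF b(2)]
    unfolding iso_pair_def space_iso_def by (auto dest: bij_betwE)
  then show "\<exists>g g' h h'. iso_pair g g' h h' S T" by blast
next
  assume "\<exists>g g' h h'. iso_pair g g' h h' S T"
  then obtain g g' h h' where i: "iso_pair g g' h h' S T" by blast
  have "bij_betw g (points S) (points T)"
    by (rule bij_betw_byWitness[where f' = g']) (use i in \<open>auto simp: iso_pair_def\<close>)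
  moreover have "bij_betw h (quant S) (quant T)"
    by (rule bij_betw_byWitness[where f' = h']) (use i in \<open>auto simp: iso_pair_def\<close>)
  ultimately show "isomorphic S T"
    using i unfolding isomorphic_def space_iso_def iso_pair_def by blast
qed

lemma iso_pairD:
  assumes "iso_pair g g' h h' S T"
  shows "wf_space S" and "wf_space T"
    and "\<And>x. x \<in> points S \<Longrightarrow> g x \<in> points T" and "\<And>x. x \<in> points S \<Longrightarrow> g' (g x) = x"
    and "\<And>y. y \<in> points T \<Longrightarrow> g' y \<in> points S" and "\<And>y. y \<in> points T \<Longrightarrow> g (g' y) = y"
    and "\<And>a. a \<in> quant S \<Longrightarrow> h a \<in> quant T" and "\<And>a. a \<in> quant S \<Longrightarrow> h' (h a) = a"
    and "\<And>b. b \<in> quant T \<Longrightarrow> h' b \<in> quant S" and "\<And>b. b \<in> quant T \<Longrightarrow> h (h' b) = b"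
    and "\<And>a b. a \<in> quant S \<Longrightarrow> b \<in> quant S \<Longrightarrow> qle S a b \<longleftrightarrow> qle T (h a) (h b)"
    and "\<And>a b. a \<in> quant S \<Longrightarrow> b \<in> quant S \<Longrightarrow> h (tensor S a b) = tensor T (h a) (h b)"
    and "\<And>x a x'. x \<in> points S \<Longrightarrow> a \<in> quant S \<Longrightarrow> x' \<in> points S \<Longrightarrow>
          (x, a, x') \<in> rho S \<longleftrightarrow> (g x, h a, g x') \<in> rho T"
  using assms unfolding iso_pair_def by blast+

lemma iso_pair_sym:
  assumes i: "iso_pair g g' h h' S T"
  shows "iso_pair g' g h' h T S"
proof -
  note d = iso_pairD[OF i]
  have t: "h' (tensor T a b) = tensor S (h' a) (h' b)" if ab: "a \<in> quant T" "b \<in> quant T" for a b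
  proof -
    have m: "tensor S (h' a) (h' b) \<in> quant S"
      using d(1) d(9)[OF ab(1)] d(9)[OF ab(2)] unfolding wf_space_def by blast
    have "h (tensor S (h' a) (h' b)) = tensor T a b"
      using d(12)[OF d(9)[OF ab(1)] d(9)[OF ab(2)]] d(10)[OF ab(1)] d(10)[OF ab(2)] by simp
    then show ?thesis using d(8)[OF m] by simp
  qed
  have q: "qle T a b \<longleftrightarrow> qle S (h' a) (h' b)" if ab: "a \<in> quant T" "b \<in> quant T" for a b
    using d(11)[OF d(9)[OF ab(1)] d(9)[OF ab(2)]] d(10)[OF ab(1)] d(10)[OF ab(2)] by simp
  have r: "(y, b, y') \<in> rho T \<longleftrightarrow> (g' y, h' b, g' y') \<in> rho S"
    if y: "y \<in> points T" "b \<in> quant T" "y' \<in> points T" for y b y'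
    using d(13)[OF d(5)[OF y(1)] d(9)[OF y(2)] d(5)[OF y(3)]]
      d(6)[OF y(1)] d(6)[OF y(3)] d(10)[OF y(2)] by simp
  show ?thesis
    unfolding iso_pair_def
    by (intro conjI ballI) (fact d t q r | rule d t q r, assumption+)+
qed

lemma isomorphic_refl: "wf_space S \<Longrightarrow> isomorphic S S"
  unfolding isomorphic_iff_iso_pair iso_pair_def
  by (intro exI[of _ "\<lambda>x. x"]) auto

lemma isomorphic_sym: "isomorphic S T \<Longrightarrow> isomorphic T S"
  unfolding isomorphic_iff_iso_pair using iso_pair_sym by blast

lemma isomorphic_trans:
  assumes "isomorphic S T" "isomorphic T U"
  shows "isomorphic S U"
proof -
  obtain g g' h h' where 1: "iso_pair g g' h h' S T"
    using assms isomorphic_iff_iso_pair by blast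
  obtain k k' l l' where 2: "iso_pair k k' l l' T U"
    using assms isomorphic_iff_iso_pair by blast
  have "iso_pair (k \<circ> g) (g' \<circ> k') (l \<circ> h) (h' \<circ> l') S U"
    using iso_pairD[OF 1] iso_pairD[OF 2] unfolding iso_pair_def by simp
  then show ?thesis using isomorphic_iff_iso_pair by blast
qed

lemma prod_space_cong:
  assumes "isomorphic S S'" "isomorphic T T'"
  shows "isomorphic (prod_space S T) (prod_space S' T')"
proof -
  obtain g g' h h' where 1: "iso_pair g g' h h' S S'"
    using assms isomorphic_iff_iso_pair by blast
  obtain k k' l l' where 2: "iso_pair k k' l l' T T'"
    using assms isomorphic_iff_iso_pair by blast
  have "wf_space (prod_space S T)" "wf_space (prod_space S' T')"
    using 1 2 by (auto simp: iso_pair_def intro: wf_prod_space)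
  then have "iso_pair (map_prod g k) (map_prod g' k') (map_prod h l) (map_prod h' l')
      (prod_space S T) (prod_space S' T')"
    using 1 2 unfolding iso_pair_def by (simp add: prod_space_def)
  then show ?thesis using isomorphic_iff_iso_pair by blast
qed

lemma mono_maps_transfer:
  assumes 1: "iso_pair g g' h h' S S'" and 2: "iso_pair k k' l l' T T'"
    and m: "m \<in> mono_maps S T"
  shows "(\<lambda>b \<in> quant S'. l (m (h' b))) \<in> mono_maps S' T'"
  using iso_pair_sym[OF 1] 2 m unfolding mono_maps_def iso_pair_def
  by (auto simp: PiE_iff)

lemma fun_space_cong:
  assumes "isomorphic S S'" "isomorphic T T'"
  shows "isomorphic (fun_space S T) (fun_space S' T')"
proof -
  obtain g g' h h' where 1: "iso_pair g g' h h' S S'"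
    using assms isomorphic_iff_iso_pair by blast
  obtain k k' l l' where 2: "iso_pair k k' l l' T T'"
    using assms isomorphic_iff_iso_pair by blast
  let ?F = "\<lambda>f. \<lambda>x \<in> points S'. k (f (g' x))"
  let ?F' = "\<lambda>f. \<lambda>x \<in> points S. k' (f (g x))"
  let ?H = "\<lambda>a. \<lambda>x \<in> points S'. \<lambda>b \<in> quant S'. l (a (g' x) (h' b))"
  let ?H' = "\<lambda>a. \<lambda>x \<in> points S. \<lambda>b \<in> quant S. l' (a (g x) (h b))"
  note sym1 = iso_pair_sym[OF 1] and sym2 = iso_pair_sym[OF 2]
  have gS: "g x \<in> points S'" "g' (g x) = x" if "x \<in> points S" for x
    using 1 that by (auto simp: iso_pair_def)
  have gS': "g' x \<in> points S" "g (g' x) = x" if "x \<in> points S'" for x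
    using 1 that by (auto simp: iso_pair_def)
  have hS: "h x \<in> quant S'" "h' (h x) = x" if "x \<in> quant S" for x
    using 1 that by (auto simp: iso_pair_def)
  have hS': "h' x \<in> quant S" "h (h' x) = x" if "x \<in> quant S'" for x
    using 1 that by (auto simp: iso_pair_def)
  have kT: "k x \<in> points T'" "k' (k x) = x" if "x \<in> points T" for x
    using 2 that by (auto simp: iso_pair_def)
  have kT': "k' x \<in> points T" "k (k' x) = x" if "x \<in> points T'" for x
    using 2 that by (auto simp: iso_pair_def)
  have lT: "l x \<in> quant T'" "l' (l x) = x" if "x \<in> quant T" for x
    using 2 that by (auto simp: iso_pair_def)
  have lT': "l' x \<in> quant T" "l (l' x) = x" if "x \<in> quant T'" for x
    using 2 that by (auto simp: iso_pair_def)
  have mq: "m b \<in> quant T" if "m \<in> mono_maps S T" "b \<in> quant S" for m b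
    using that by (auto simp: mono_maps_def)
  have mq': "m b \<in> quant T'" if "m \<in> mono_maps S' T'" "b \<in> quant S'" for m b
    using that by (auto simp: mono_maps_def)
  have me: "m b = undefined" if "m \<in> mono_maps S T" "b \<notin> quant S" for m b
    using that by (auto simp: mono_maps_def PiE_iff extensional_def)
  have me': "m b = undefined" if "m \<in> mono_maps S' T'" "b \<notin> quant S'" for m b
    using that by (auto simp: mono_maps_def PiE_iff extensional_def)
  have w: "wf_space (fun_space S T)" "wf_space (fun_space S' T')"
    using 1 2 by (auto simp: iso_pair_def intro: wf_fun_space)
  have F: "?F f \<in> points S' \<rightarrow>\<^sub>E points T'" "?F' (?F f) = f"
    if f: "f \<in> points S \<rightarrow>\<^sub>E points T" for f
  proof -
    show "?F f \<in> points S' \<rightarrow>\<^sub>E points T'" using f gS' kT by auto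
    show "?F' (?F f) = f"
    proof
      fix x show "?F' (?F f) x = f x"
        using f gS kT by (cases "x \<in> points S") (auto simp: PiE_iff extensional_def)
    qed
  qed
  have F': "?F' f \<in> points S \<rightarrow>\<^sub>E points T" "?F (?F' f) = f"
    if f: "f \<in> points S' \<rightarrow>\<^sub>E points T'" for f
  proof -
    show "?F' f \<in> points S \<rightarrow>\<^sub>E points T" using f gS kT' by auto
    show "?F (?F' f) = f"
    proof
      fix x show "?F (?F' f) x = f x"
        using f gS' kT' by (cases "x \<in> points S'") (auto simp: PiE_iff extensional_def)
    qed
  qed
  have H: "?H a \<in> points S' \<rightarrow>\<^sub>E mono_maps S' T'" "?H' (?H a) = a"
    if a: "a \<in> points S \<rightarrow>\<^sub>E mono_maps S T" for a
  proof -
    show "?H a \<in> points S' \<rightarrow>\<^sub>E mono_maps S' T'"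
      using a gS' mono_maps_transfer[OF 1 2] by (auto simp: PiE_iff)
    show "?H' (?H a) = a"
    proof (intro ext)
      fix x b show "?H' (?H a) x b = a x b"
      proof (cases "x \<in> points S")
        case True
        then have m: "a x \<in> mono_maps S T" using a by auto
        show ?thesis
          using True gS hS lT mq[OF m] me[OF m, of b] by (cases "b \<in> quant S") simp_all
      qed (use a in \<open>auto simp: PiE_iff extensional_def\<close>)
    qed
  qed
  have H': "?H' a \<in> points S \<rightarrow>\<^sub>E mono_maps S T" "?H (?H' a) = a"
    if a: "a \<in> points S' \<rightarrow>\<^sub>E mono_maps S' T'" for a
  proof -
    show "?H' a \<in> points S \<rightarrow>\<^sub>E mono_maps S T"
      using a gS mono_maps_transfer[OF sym1 sym2] by (auto simp: PiE_iff)
    show "?H (?H' a) = a"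
    proof (intro ext)
      fix x b show "?H (?H' a) x b = a x b"
      proof (cases "x \<in> points S'")
        case True
        then have m: "a x \<in> mono_maps S' T'" using a by auto
        show ?thesis
          using True gS' hS' lT' mq'[OF m] me'[OF m, of b] by (cases "b \<in> quant S'") simp_all
      qed (use a in \<open>auto simp: PiE_iff extensional_def\<close>)
    qed
  qed
  have aq: "a x b \<in> quant T" if "a \<in> points S \<rightarrow>\<^sub>E mono_maps S T" "x \<in> points S" "b \<in> quant S" for a x b
    using that mq by (meson PiE_mem)
  have L: "(\<forall>x \<in> points S. \<forall>b \<in> quant S. qle T (a x b) (a' x b)) \<longleftrightarrow>
      (\<forall>x \<in> points S'. \<forall>b \<in> quant S'. qle T' (?H a x b) (?H a' x b))"
    if a: "a \<in> points S \<rightarrow>\<^sub>E mono_maps S T" "a' \<in> points S \<rightarrow>\<^sub>E mono_maps S T" for a a'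
  proof -
    have q: "qle T (a x b) (a' x b) \<longleftrightarrow> qle T' (l (a x b)) (l (a' x b))"
      if "x \<in> points S" "b \<in> quant S" for x b
      using 2 aq[OF a(1) that] aq[OF a(2) that] by (auto simp: iso_pair_def)
    show ?thesis
    proof (intro iffI ballI)
      fix x b assume "\<forall>x \<in> points S. \<forall>b \<in> quant S. qle T (a x b) (a' x b)"
        "x \<in> points S'" "b \<in> quant S'"
      then show "qle T' (?H a x b) (?H a' x b)" using q gS' hS' by simp
    next
      fix x b assume A: "\<forall>x \<in> points S'. \<forall>b \<in> quant S'. qle T' (?H a x b) (?H a' x b)"
        and xb: "x \<in> points S" "b \<in> quant S"
      have "qle T' (?H a (g x) (h b)) (?H a' (g x) (h b))" using A xb gS hS by blast
      then show "qle T (a x b) (a' x b)" using q xb gS hS by simp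
    qed
  qed
  have N: "?H (\<lambda>x \<in> points S. \<lambda>b \<in> quant S. tensor T (a x b) (a' x b)) =
      (\<lambda>x \<in> points S'. \<lambda>b \<in> quant S'. tensor T' (?H a x b) (?H a' x b))"
    if a: "a \<in> points S \<rightarrow>\<^sub>E mono_maps S T" "a' \<in> points S \<rightarrow>\<^sub>E mono_maps S T" for a a'
  proof -
    have "l (tensor T (a x b) (a' x b)) = tensor T' (l (a x b)) (l (a' x b))"
      if "x \<in> points S" "b \<in> quant S" for x b
      using 2 aq[OF a(1) that] aq[OF a(2) that] by (auto simp: iso_pair_def)
    then show ?thesis using gS' hS' by (auto simp: fun_eq_iff restrict_def)
  qed
  have rT: "(y, c, y') \<in> rho T \<longleftrightarrow> (k y, l c, k y') \<in> rho T'"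
    if "y \<in> points T" "c \<in> quant T" "y' \<in> points T" for y c y'
    using 2 that by (auto simp: iso_pair_def)
  have rS: "(x, b, x') \<in> rho S \<longleftrightarrow> (g x, h b, g x') \<in> rho S'"
    if "x \<in> points S" "b \<in> quant S" "x' \<in> points S" for x b x'
    using 1 that by (auto simp: iso_pair_def)
  have wS: "wf_space S" "wf_space S'"
    using 1 by (simp_all add: iso_pair_def)
  have sub: "x \<in> points S \<and> b \<in> quant S \<and> x' \<in> points S" if "(x, b, x') \<in> rho S" for x b x'
    using wS(1) that unfolding wf_space_def by auto
  have sub': "x \<in> points S' \<and> b \<in> quant S' \<and> x' \<in> points S'" if "(x, b, x') \<in> rho S'" for x b x'
    using wS(2) that unfolding wf_space_def by auto
  have R: "(\<forall>x b x'. (x, b, x') \<in> rho S \<longrightarrow> (f x, a x b, f' x') \<in> rho T \<and> (f x, a x b, f x') \<in> rho T)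
     \<longleftrightarrow> (\<forall>x b x'. (x, b, x') \<in> rho S' \<longrightarrow>
        (?F f x, ?H a x b, ?F f' x') \<in> rho T' \<and> (?F f x, ?H a x b, ?F f x') \<in> rho T')" (is "?l \<longleftrightarrow> ?r")
    if f: "f \<in> points S \<rightarrow>\<^sub>E points T" "f' \<in> points S \<rightarrow>\<^sub>E points T"
      and a: "a \<in> points S \<rightarrow>\<^sub>E mono_maps S T" for f f' a
  proof -
    have e: "(p x, a x b, q x') \<in> rho T \<longleftrightarrow> (?F p (g x), ?H a (g x) (h b), ?F q (g x')) \<in> rho T'"
      if "x \<in> points S" "b \<in> quant S" "x' \<in> points S"
        "p \<in> points S \<rightarrow>\<^sub>E points T" "q \<in> points S \<rightarrow>\<^sub>E points T" for p q x b x'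
    proof -
      have "p x \<in> points T" "q x' \<in> points T" using that by auto
      then show ?thesis using rT[of "p x" "a x b" "q x'"] aq[OF a, of x b] that gS hS by simp
    qed
    show ?thesis
    proof
      assume l: ?l
      show ?r
      proof (intro allI impI)
        fix x b x' assume r: "(x, b, x') \<in> rho S'"
        note s = sub'[OF r]
        have "(g' x, h' b, g' x') \<in> rho S" using rS r s gS' hS' by simp
        then have "(f (g' x), a (g' x) (h' b), f' (g' x')) \<in> rho T"
          "(f (g' x), a (g' x) (h' b), f (g' x')) \<in> rho T" using l by blast+
        then show "(?F f x, ?H a x b, ?F f' x') \<in> rho T' \<and> (?F f x, ?H a x b, ?F f x') \<in> rho T'"
          using e[of "g' x" "h' b" "g' x'" f f'] e[of "g' x" "h' b" "g' x'" f f] f s gS' hS' by simp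
      qed
    next
      assume r: ?r
      show ?l
      proof (intro allI impI)
        fix x b x' assume x: "(x, b, x') \<in> rho S"
        note s = sub[OF x]
        have "(g x, h b, g x') \<in> rho S'" using rS x s by simp
        then show "(f x, a x b, f' x') \<in> rho T \<and> (f x, a x b, f x') \<in> rho T"
          using r e[of x b x' f f'] e[of x b x' f f] f s by blast
      qed
    qed
  qed
  have "iso_pair ?F ?F' ?H ?H' (fun_space S T) (fun_space S' T')"
    unfolding iso_pair_def
  proof (intro conjI ballI)
    fix f f' a assume "f \<in> points (fun_space S T)" "a \<in> quant (fun_space S T)"
      "f' \<in> points (fun_space S T)"
    then have m: "f \<in> points S \<rightarrow>\<^sub>E points T" "a \<in> points S \<rightarrow>\<^sub>E mono_maps S T"
      "f' \<in> points S \<rightarrow>\<^sub>E points T"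
      by (auto simp: fun_space_def)
    show "(f, a, f') \<in> rho (fun_space S T) \<longleftrightarrow> (?F f, ?H a, ?F f') \<in> rho (fun_space S' T')"
      using R[OF m(1,3,2)] F(1)[OF m(1)] F(1)[OF m(3)] H(1)[OF m(2)] m
      unfolding fun_space_def space.simps mem_Collect_eq prod.case by blast
  next
    fix a b assume m: "a \<in> quant (fun_space S T)" "b \<in> quant (fun_space S T)"
    show "qle (fun_space S T) a b \<longleftrightarrow> qle (fun_space S' T') (?H a) (?H b)"
      using L m unfolding fun_space_def space.simps by blast
    show "?H (tensor (fun_space S T) a b) = tensor (fun_space S' T') (?H a) (?H b)"
      using N m unfolding fun_space_def space.simps by blast
  next
    fix f assume "f \<in> points (fun_space S T)"
    then have m: "f \<in> points S \<rightarrow>\<^sub>E points T" by (simp add: fun_space_def)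
    show "?F f \<in> points (fun_space S' T')" using F(1)[OF m] by (simp add: fun_space_def)
    show "?F' (?F f) = f" by (rule F(2)[OF m])
  next
    fix f assume "f \<in> points (fun_space S' T')"
    then have m: "f \<in> points S' \<rightarrow>\<^sub>E points T'" by (simp add: fun_space_def)
    show "?F' f \<in> points (fun_space S T)" using F'(1)[OF m] by (simp add: fun_space_def)
    show "?F (?F' f) = f" by (rule F'(2)[OF m])
  next
    fix a assume "a \<in> quant (fun_space S T)"
    then have m: "a \<in> points S \<rightarrow>\<^sub>E mono_maps S T" by (simp add: fun_space_def)
    show "?H a \<in> quant (fun_space S' T')" using H(1)[OF m] by (simp add: fun_space_def)
    show "?H' (?H a) = a" by (rule H(2)[OF m])
  next
    fix a assume "a \<in> quant (fun_space S' T')"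
    then have m: "a \<in> points S' \<rightarrow>\<^sub>E mono_maps S' T'" by (simp add: fun_space_def)
    show "?H' a \<in> quant (fun_space S T)" using H'(1)[OF m] by (simp add: fun_space_def)
    show "?H (?H' a) = a" by (rule H'(2)[OF m])
  qed (use w in auto)
  then show ?thesis using isomorphic_iff_iso_pair by blast
qed

lemma interprets_unique:
  fixes S :: "('x, 'q) space" and S' :: "('y, 'r) space"
  assumes "interprets A S" "interprets A S'"
  shows "isomorphic S S'"
  using assms
proof (induction A arbitrary: S S')
  case RealT
  then have "isomorphic S real_space" "isomorphic S' real_space" by simp_all
  then show ?case using isomorphic_sym isomorphic_trans by metis
next
  case (ProdT A B)
  obtain U V :: "('x, 'q) space" where 1: "interprets A U" "interprets B V" "isomorphic S (prod_space U V)"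
    using ProdT.prems by auto
  obtain U' V' :: "('y, 'r) space" where 2: "interprets A U'" "interprets B V'" "isomorphic S' (prod_space U' V')"
    using ProdT.prems by auto
  show ?case
    by (rule isomorphic_trans[OF isomorphic_trans[OF 1(3) prod_space_cong] isomorphic_sym[OF 2(3)]])
      (rule ProdT.IH(1)[OF 1(1) 2(1)], rule ProdT.IH(2)[OF 1(2) 2(2)])
next
  case (FunT A B)
  obtain U V :: "('x, 'q) space" where 1: "interprets A U" "interprets B V" "isomorphic S (fun_space U V)"
    using FunT.prems by auto
  obtain U' V' :: "('y, 'r) space" where 2: "interprets A U'" "interprets B V'" "isomorphic S' (fun_space U' V')"
    using FunT.prems by auto
  show ?case
    by (rule isomorphic_trans[OF isomorphic_trans[OF 1(3) fun_space_cong] isomorphic_sym[OF 2(3)]])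
      (rule FunT.IH(1)[OF 1(1) 2(1)], rule FunT.IH(2)[OF 1(2) 2(2)])
qed

lemma interprets_isomorphic:
  fixes S S' :: "('x, 'q) space"
  assumes "interprets A S" "isomorphic S S'"
  shows "interprets A S'"
proof (cases A)
  case RealT
  then show ?thesis using assms isomorphic_trans[OF isomorphic_sym[OF assms(2)]] by simp
next
  case (ProdT B C)
  then show ?thesis using assms(1) isomorphic_trans[OF isomorphic_sym[OF assms(2)]] by auto
next
  case (FunT B C)
  then show ?thesis using assms(1) isomorphic_trans[OF isomorphic_sym[OF assms(2)]] by auto
qed

text \<open>Copy of a space along injections into larger HOL types.\<close>

definition copy :: "('x \<Rightarrow> 'y) \<Rightarrow> ('q \<Rightarrow> 'r) \<Rightarrow> ('x, 'q) space \<Rightarrow> ('y, 'r) space" where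
  "copy g h S =
     \<lparr> points = g ` points S,
       quant = h ` quant S,
       qle = (\<lambda>a b. qle S (inv h a) (inv h b)),
       tensor = (\<lambda>a b. h (tensor S (inv h a) (inv h b))),
       rho = (\<lambda>(x, a, x'). (g x, h a, g x')) ` rho S \<rparr>"

lemma isomorphic_copy:
  assumes g: "inj g" and h: "inj h" and S: "wf_space S"
  shows "isomorphic S (copy g h S)"
proof -
  have "wf_space (copy g h S)"
    using S unfolding wf_space_def copy_def by (auto simp: inv_f_f[OF h])
  then have "iso_pair g (inv g) h (inv h) S (copy g h S)"
    using S unfolding iso_pair_def copy_def
    by (force simp: inv_f_f[OF h] inv_f_f[OF g] image_iff dest: injD[OF g] injD[OF h])
  then show ?thesis using isomorphic_iff_iso_pair by blast
qed

lemma interprets_copy: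
  fixes g :: "'x \<Rightarrow> 'y" and h :: "'q \<Rightarrow> 'r"
  assumes g: "inj g" and h: "inj h" and S: "interprets A S"
  shows "interprets A (copy g h S)"
  using S
proof (induction A arbitrary: S)
  case RealT
  then have "isomorphic S real_space" by simp
  then have "isomorphic (copy g h S) real_space"
    by (intro isomorphic_trans[OF isomorphic_sym[OF isomorphic_copy[OF g h]]])
      (auto dest: isomorphic_wf)
  then show ?case by simp
next
  case (ProdT A B)
  obtain U V :: "('x, 'q) space" where 1: "interprets A U" "interprets B V" "isomorphic S (prod_space U V)"
    using ProdT.prems by auto
  have "isomorphic (copy g h S) (prod_space (copy g h U) (copy g h V))"
  proof -
    have "isomorphic (copy g h S) S"
      using isomorphic_sym[OF isomorphic_copy[OF g h]] isomorphic_wf[OF 1(3)] by simp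
    moreover have "isomorphic (prod_space U V) (prod_space (copy g h U) (copy g h V))"
      by (intro prod_space_cong isomorphic_copy g h interprets_wf[OF 1(1)] interprets_wf[OF 1(2)])
    ultimately show ?thesis by (rule isomorphic_trans[OF _ isomorphic_trans[OF 1(3)]])
  qed
  then show ?case
    unfolding interprets.simps by (intro exI conjI) (rule ProdT.IH(1)[OF 1(1)], rule ProdT.IH(2)[OF 1(2)])
next
  case (FunT A B)
  obtain U V :: "('x, 'q) space" where 1: "interprets A U" "interprets B V" "isomorphic S (fun_space U V)"
    using FunT.prems by auto
  have "isomorphic (copy g h S) (fun_space (copy g h U) (copy g h V))"
  proof -
    have "isomorphic (copy g h S) S"
      using isomorphic_sym[OF isomorphic_copy[OF g h]] isomorphic_wf[OF 1(3)] by simp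
    moreover have "isomorphic (fun_space U V) (fun_space (copy g h U) (copy g h V))"
      by (intro fun_space_cong isomorphic_copy g h interprets_wf[OF 1(1)] interprets_wf[OF 1(2)])
    ultimately show ?thesis by (rule isomorphic_trans[OF _ isomorphic_trans[OF 1(3)]])
  qed
  then show ?case
    unfolding interprets.simps by (intro exI conjI) (rule FunT.IH(1)[OF 1(1)], rule FunT.IH(2)[OF 1(2)])
qed

lemma interprets_RealT: "interprets RealT real_space"
  by (simp add: isomorphic_refl wf_real_space)

lemma interprets_ProdT:
  fixes S :: "('x, 'q) space" and T :: "('y, 'r) space"
  assumes S: "interprets A S" and T: "interprets B T"
  shows "\<exists>U :: ('x + 'y + 'x \<times> 'y, 'q + 'r + 'q \<times> 'r) space.
           interprets (ProdT A B) U \<and> isomorphic U (prod_space S T)"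
proof -
  have wf: "wf_space S" "wf_space T" "wf_space (prod_space S T)"
    by (simp_all only: interprets_wf[OF S] interprets_wf[OF T] wf_prod_space)
  let ?S = "copy Inl Inl S :: ('x + 'y + 'x \<times> 'y, 'q + 'r + 'q \<times> 'r) space"
  let ?T = "copy (Inr \<circ> Inl) (Inr \<circ> Inl) T :: ('x + 'y + 'x \<times> 'y, 'q + 'r + 'q \<times> 'r) space"
  let ?U = "copy (Inr \<circ> Inr) (Inr \<circ> Inr) (prod_space S T)
              :: ('x + 'y + 'x \<times> 'y, 'q + 'r + 'q \<times> 'r) space"
  have 1: "interprets A ?S" "isomorphic S ?S"
    by (rule interprets_copy isomorphic_copy; simp add: S wf)+
  have 2: "interprets B ?T" "isomorphic T ?T"
    by (rule interprets_copy isomorphic_copy; simp add: T wf inj_on_def)+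
  have 3: "isomorphic ?U (prod_space S T)"
    by (rule isomorphic_sym[OF isomorphic_copy]; simp add: wf inj_on_def)
  have "interprets (ProdT A B) ?U"
    unfolding interprets.simps
    by (intro exI conjI) (rule 1(1), rule 2(1), rule isomorphic_trans[OF 3 prod_space_cong[OF 1(2) 2(2)]])
  then show ?thesis using 3 by blast
qed

lemma interprets_FunT:
  fixes S :: "('x, 'q) space" and T :: "('y, 'r) space"
  assumes S: "interprets A S" and T: "interprets B T"
  shows "\<exists>U :: ('x + 'y + ('x \<Rightarrow> 'y), 'q + 'r + ('x \<Rightarrow> 'q \<Rightarrow> 'r)) space.
           interprets (FunT A B) U \<and> isomorphic U (fun_space S T)"
proof -
  have wf: "wf_space S" "wf_space T" "wf_space (fun_space S T)"
    by (simp_all only: interprets_wf[OF S] interprets_wf[OF T] wf_fun_space)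
  let ?S = "copy Inl Inl S :: ('x + 'y + ('x \<Rightarrow> 'y), 'q + 'r + ('x \<Rightarrow> 'q \<Rightarrow> 'r)) space"
  let ?T = "copy (Inr \<circ> Inl) (Inr \<circ> Inl) T
              :: ('x + 'y + ('x \<Rightarrow> 'y), 'q + 'r + ('x \<Rightarrow> 'q \<Rightarrow> 'r)) space"
  let ?U = "copy (Inr \<circ> Inr) (Inr \<circ> Inr) (fun_space S T)
              :: ('x + 'y + ('x \<Rightarrow> 'y), 'q + 'r + ('x \<Rightarrow> 'q \<Rightarrow> 'r)) space"
  have 1: "interprets A ?S" "isomorphic S ?S"
    by (rule interprets_copy isomorphic_copy; simp add: S wf)+
  have 2: "interprets B ?T" "isomorphic T ?T"
    by (rule interprets_copy isomorphic_copy; simp add: T wf inj_on_def)+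
  have 3: "isomorphic ?U (fun_space S T)"
    by (rule isomorphic_sym[OF isomorphic_copy]; simp add: wf inj_on_def)
  have "interprets (FunT A B) ?U"
    unfolding interprets.simps
    by (intro exI conjI) (rule 1(1), rule 2(1), rule isomorphic_trans[OF 3 fun_space_cong[OF 1(2) 2(2)]])
  then show ?thesis using 3 by blast
qed

end

theory Submission
  imports Defs
begin

text \<open>The triangle inequality through the intermediate value \<open>f' x\<close> splits the
  distance from \<open>f x\<close> to \<open>f' x'\<close> into a gap between the two functions at
  one point, bounded by \<open>a\<close>, and a variation of \<open>f'\<close> alone, bounded by
  \<open>a'\<close>. The variation of \<open>f\<close> is bounded by \<open>a'\<close>, hence by the
  sum, as values in \<open>ennreal\<close> are nonnegative.\<close>

theorem theorem6p5:
  fixes A :: ty and S :: "('x, 'q) space"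
    and f f' :: "'x \<Rightarrow> real" and a a' :: "'x \<Rightarrow> 'q \<Rightarrow> ennreal"
  assumes "interprets A S"
    and "f \<in> points (fun_space S real_space)" and "f' \<in> points (fun_space S real_space)"
    and "a \<in> quant (fun_space S real_space)" and "a' \<in> quant (fun_space S real_space)"
    and "\<forall>x b x'. (x, b, x') \<in> rho S \<longrightarrow> ennreal \<bar>f x - f' x\<bar> \<le> a x b"
    and "(f, a', f) \<in> rho (fun_space S real_space)"
    and "(f', a', f') \<in> rho (fun_space S real_space)"
  shows "(f, tensor (fun_space S real_space) a a', f') \<in> rho (fun_space S real_space)"
proof -
  let ?F = "fun_space S real_space" and ?t = "tensor (fun_space S real_space) a a'"
  have wS: "wf_space S"
    using assms(1) by (rule interprets_wf)
  \<comment> \<open>Membership in \<open>rho ?F\<close> also demands a middle component in the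
    quantale, so closure under \<open>tensor\<close> is needed.\<close>
  have t_quant: "?t \<in> quant ?F"
    using wf_fun_space[OF wS wf_real_space] assms(4,5) unfolding wf_space_def by blast
  have "ennreal \<bar>f x - f' x'\<bar> \<le> ?t x b \<and> ennreal \<bar>f x - f x'\<bar> \<le> ?t x b"
    if r: "(x, b, x') \<in> rho S" for x b x'
  proof -
    \<comment> \<open>The tensor is a restricted function, equal to the pointwise sum only on the
      carriers; \<open>wf_space S\<close> keeps triples of \<open>rho S\<close> inside them.\<close>
    have "x \<in> points S" "b \<in> quant S"
      using wS r unfolding wf_space_def by auto
    then have t: "?t x b = a x b + a' x b"
      by (simp add: fun_space_def real_space_def)
    have f: "ennreal \<bar>f x - f x'\<bar> \<le> a' x b" and f': "ennreal \<bar>f' x - f' x'\<bar> \<le> a' x b"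
      using assms(7,8) r by (auto simp: fun_space_def real_space_def)
    have "ennreal \<bar>f x - f' x'\<bar> \<le> ennreal (\<bar>f x - f' x\<bar> + \<bar>f' x - f' x'\<bar>)"
      by (intro ennreal_leI) linarith
    also have "\<dots> = ennreal \<bar>f x - f' x\<bar> + ennreal \<bar>f' x - f' x'\<bar>"
      by (simp add: ennreal_plus)
    also have "\<dots> \<le> a x b + a' x b"
      using assms(6) r f' by (intro add_mono) auto
    finally show ?thesis
      \<comment> \<open>\<open>add_increasing\<close> settles the second conjunct by adding
        \<open>a x b\<close> \<ge> 0 to the bound in \<open>f\<close>.\<close>
      using t f by (simp add: add_increasing)
  qed
  then show ?thesis
    using assms(2,3) t_quant by (simp add: fun_space_def real_space_def)
qed

end
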